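(* For every $\phi\in\mathcal{C}$ there is an overhardian $y\in\mathcal{C}^{\infty}$ such that $y^{\langle m\rangle}>_{\mathrm{e}}\phi$ for all $m\in\mathbb{N}$.
   Context: $\mathcal{C}$ is the ring of germs at $+\infty$ of continuous real functions on intervals $[a,+\infty)$; $\mathcal{C}^\infty$ the subring of germs of $C^\infty$ functions; $\mathcal{C}^{<\infty}$ the differential ring of germs that are $C^n$ for all $n$. For $g,h\in\mathcal{C}$, $g<_{\mathrm{e}}h$ means $g(t)<h(t)$ eventually. For $y\in\mathcal{C}^{<\infty}$ set $y^{\langle 0\rangle}:=y$, and if $y^{\langle i\rangle}$ is defined and a unit of $\mathcal{C}^{<\infty}$, set $y^{\langle i+1\rangle}:=(y^{\langle i\rangle})'/y^{\langle i\rangle}$ (otherwise undefined). $y$ is overhardian if for all $i$, $y^{\langle i\rangle}$ is defined, $y^{\langle i\rangle}>_{\mathrm{e}}0$, and $y^{\langle i\rangle}>_{\mathrm{e}}y^{\langle i+1\rangle}$. *)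

theory Defs
  imports "HOL-Analysis.Analysis"
begin

text \<open>
  A germ is represented by a total function; only its values near infinity matter, so every
  function on some \<open>[a, \<infinity>)\<close> has a germ.
\<close>

quotient_type germ = "real \<Rightarrow> real" / "\<lambda>f g. \<forall>\<^sub>F t in at_top. f t = g t"
proof (rule equivpI)
  show "reflp (\<lambda>f g :: real \<Rightarrow> real. \<forall>\<^sub>F t in at_top. f t = g t)"
    by (rule reflpI) simp
  show "symp (\<lambda>f g :: real \<Rightarrow> real. \<forall>\<^sub>F t in at_top. f t = g t)"
    by (rule sympI) (simp add: eq_commute)
  show "transp (\<lambda>f g :: real \<Rightarrow> real. \<forall>\<^sub>F t in at_top. f t = g t)"
    by (rule transpI) (erule (1) eventually_elim2, simp)
qed

lift_definition germ_of :: "(real \<Rightarrow> real) \<Rightarrow> germ" is "\<lambda>f. f" .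

instantiation germ :: comm_ring_1
begin

lift_definition zero_germ :: germ is "\<lambda>_. 0" .

lift_definition one_germ :: germ is "\<lambda>_. 1" .

lift_definition plus_germ :: "germ \<Rightarrow> germ \<Rightarrow> germ" is "\<lambda>f g t. f t + g t"
  by (erule (1) eventually_elim2, simp)

lift_definition minus_germ :: "germ \<Rightarrow> germ \<Rightarrow> germ" is "\<lambda>f g t. f t - g t"
  by (erule (1) eventually_elim2, simp)

lift_definition uminus_germ :: "germ \<Rightarrow> germ" is "\<lambda>f t. - f t"
  by (erule eventually_mono, simp)

lift_definition times_germ :: "germ \<Rightarrow> germ \<Rightarrow> germ" is "\<lambda>f g t. f t * g t"
  by (erule (1) eventually_elim2, simp)

instance
  by standard (transfer, simp add: algebra_simps)+

end

instantiation germ :: inverse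
begin

lift_definition inverse_germ :: "germ \<Rightarrow> germ" is "\<lambda>f t. inverse (f t)"
  by (erule eventually_mono, simp)

lift_definition divide_germ :: "germ \<Rightarrow> germ \<Rightarrow> germ" is "\<lambda>f g t. f t / g t"
  by (erule (1) eventually_elim2, simp)

instance ..

end

text \<open>On units, the pointwise quotient is division in the ring of germs.\<close>

lemma germ_divide_unit:
  fixes g u v :: germ
  assumes "u * v = 1"
  shows "g / u = g * v"
  using assms
proof (transfer, elim eventually_mono)
  fix u v g :: "real \<Rightarrow> real" and t
  assume "u t * v t = 1"
  then have "v t = inverse (u t)"
    by (metis inverse_unique)
  then show "g t / u t = g t * v t"
    by (simp add: divide_inverse)
qed

lift_definition germ_less :: "germ \<Rightarrow> germ \<Rightarrow> bool"  (infix "<\<^sub>e" 50)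
  is "\<lambda>f g. \<forall>\<^sub>F t in at_top. f t < g t"
proof -
  fix f f' g g' :: "real \<Rightarrow> real"
  assume "\<forall>\<^sub>F t in at_top. f t = f' t" and "\<forall>\<^sub>F t in at_top. g t = g' t"
  then have "\<forall>\<^sub>F t in at_top. (f t < g t) = (f' t < g' t)"
    by eventually_elim simp
  then show "(\<forall>\<^sub>F t in at_top. f t < g t) = (\<forall>\<^sub>F t in at_top. f' t < g' t)"
    by (rule eventually_subst)
qed

lift_definition germ_deriv :: "germ \<Rightarrow> germ" is "\<lambda>f. deriv f"
proof -
  fix f g :: "real \<Rightarrow> real"
  assume "\<forall>\<^sub>F t in at_top. f t = g t"
  then obtain a where a: "\<And>t. t > a \<Longrightarrow> f t = g t"
    by (auto simp: eventually_at_top_dense)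
  have "deriv f t = deriv g t" if "t > a" for t
  proof (rule deriv_cong_ev)
    show "\<forall>\<^sub>F x in nhds t. f x = g x"
      using eventually_nhds_in_open[of "{a<..}" t] that
      by (auto elim!: eventually_mono intro: a)
  qed simp
  then show "\<forall>\<^sub>F t in at_top. deriv f t = deriv g t"
    by (auto simp: eventually_at_top_dense)
qed

text \<open>\<open>C_on n a f\<close>: the restriction of \<open>f\<close> to \<open>[a, \<infinity>)\<close> is \<open>n\<close> times continuously
  differentiable (one-sidedly at \<open>a\<close>).\<close>

primrec C_on :: "nat \<Rightarrow> real \<Rightarrow> (real \<Rightarrow> real) \<Rightarrow> bool" where
  "C_on 0 a f \<longleftrightarrow> continuous_on {a..} f"
| "C_on (Suc n) a f \<longleftrightarrow>
    (\<exists>f'. (\<forall>x\<ge>a. (f has_real_derivative f' x) (at x within {a..})) \<and> C_on n a f')"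

definition C_germs :: "germ set" where
  "C_germs = {germ_of f | f. \<exists>a. continuous_on {a..} f}"

definition C_n_germs :: "nat \<Rightarrow> germ set" where
  "C_n_germs n = {germ_of f | f. \<exists>a. C_on n a f}"

text \<open>In \<open>C_infty_germs\<close> one interval \<open>[a, \<infinity>)\<close> serves all \<open>n\<close>, whereas in
  \<open>C_lt_infty_germs\<close> the interval may depend on \<open>n\<close>.\<close>

definition C_infty_germs :: "germ set" where
  "C_infty_germs = {germ_of f | f. \<exists>a. \<forall>n. C_on n a f}"

definition C_lt_infty_germs :: "germ set" where
  "C_lt_infty_germs = (\<Inter>n. C_n_germs n)"

definition unit_C_lt_infty :: "germ \<Rightarrow> bool" where
  "unit_C_lt_infty y \<longleftrightarrow> y \<in> C_lt_infty_germs \<and> (\<exists>z\<in>C_lt_infty_germs. y * z = 1)"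

text \<open>\<open>iter_logderiv y i\<close> is \<open>y\<^bsup>\<langle>i\<rangle>\<^esup>\<close>, with \<open>None\<close> for ``undefined''.\<close>

primrec iter_logderiv :: "germ \<Rightarrow> nat \<Rightarrow> germ option" where
  "iter_logderiv y 0 = Some y"
| "iter_logderiv y (Suc i) =
    (case iter_logderiv y i of
       None \<Rightarrow> None
     | Some u \<Rightarrow> if unit_C_lt_infty u then Some (germ_deriv u / u) else None)"

definition overhardian :: "germ \<Rightarrow> bool" where
  "overhardian y \<longleftrightarrow> y \<in> C_lt_infty_germs \<and>
    (\<forall>i. \<exists>u v. iter_logderiv y i = Some u \<and> iter_logderiv y (Suc i) = Some v \<and>
      0 <\<^sub>e u \<and> v <\<^sub>e u)"

end

theory Submission imports Defs
begin

text \<open>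
  Let \<open>s\<^sub>m\<close> be a smooth step that vanishes on \<open>(-\<infinity>, m]\<close> and equals a constant \<open>c\<^sub>m\<close> on \<open>[m + 1, \<infinity>)\<close>.
  The infinite system \<open>y\<^sub>m(t) = s\<^sub>m(t) exp (\<integral>\<^sub>0\<^sup>t y\<^sub>m\<^sub>+\<^sub>1)\<close> has a solution, because every \<open>y\<^sub>m\<close> must
  vanish on \<open>[0, m]\<close>, so that only finitely many equations matter at any given \<open>t\<close>. For
  \<open>t > m + 1\<close> it says that \<open>y\<^sub>m\<^sub>+\<^sub>1\<close> is the logarithmic derivative of \<open>y\<^sub>m\<close>. If the
  \<open>y\<^sub>m\<close> are continuous, the system itself makes all of them smooth.

  The steps are shaped so that they may rise arbitrarily high within unit time while
  \<open>y\<^sub>m\<^sub>+\<^sub>1 < y\<^sub>m\<close>: up to height 8 this holds since \<open>y\<^sub>m \<ge> c\<^sub>m > 8\<close>, and above it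
  \<open>s' \<le> s\<^sup>2\<close> makes \<open>y\<^sub>m\<^sub>+\<^sub>1 / y\<^sub>m\<close> nonincreasing. Hence the \<open>c\<^sub>m\<close> can be chosen above
  \<open>\<phi>\<close> on \<open>[m + 1, m + 2]\<close>, and at later times \<open>y\<^sub>m\<close> exceeds \<open>\<phi>\<close> because it exceeds \<open>y\<^sub>j\<close> for a larger
  \<open>j\<close>.
\<close>

section \<open>Closure properties of \<open>C_on\<close>\<close>

lemma C_on_SucD: "C_on (Suc n) a f \<Longrightarrow> C_on n a f"
proof (induction n arbitrary: f)
  case 0
  then show ?case
    by (auto simp: continuous_on_eq_continuous_within intro: DERIV_continuous)
next
  case (Suc n)
  then show ?case by (metis C_on.simps(2))
qed

lemma C_on_SucI:
  assumes "\<And>x. x \<ge> a \<Longrightarrow> (f has_real_derivative f' x) (at x within {a..})" "C_on n a f'"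
  shows "C_on (Suc n) a f"
  using assms by auto

lemma C_on_subset: "C_on n a f \<Longrightarrow> a \<le> b \<Longrightarrow> C_on n b f"
proof (induction n arbitrary: f)
  case 0
  then show ?case by (auto intro: continuous_on_subset)
next
  case (Suc n)
  from Suc.prems obtain f' where f':
    "\<forall>x\<ge>a. (f has_real_derivative f' x) (at x within {a..})" "C_on n a f'"
    by auto
  show ?case
  proof (rule C_on_SucI)
    show "(f has_real_derivative f' x) (at x within {b..})" if "x \<ge> b" for x
      by (rule DERIV_subset[of f _ _ "{a..}"]) (use f'(1) that Suc.prems(2) in auto)
    show "C_on n b f'" using f'(2) Suc.prems(2) by (rule Suc.IH)
  qed
qed

lemma C_on_cong:
  assumes "\<And>x. x \<ge> a \<Longrightarrow> f x = g x" "C_on n a f"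
  shows "C_on n a g"
proof (cases n)
  case 0
  have "continuous_on {a..} f \<longleftrightarrow> continuous_on {a..} g"
    by (rule continuous_on_cong) (use assms(1) in auto)
  with 0 assms(2) show ?thesis by simp
next
  case (Suc k)
  with assms(2) obtain f' where f': "\<forall>x\<ge>a. (f has_real_derivative f' x) (at x within {a..})" "C_on k a f'"
    by auto
  have "(g has_real_derivative f' x) (at x within {a..})" if "x \<ge> a" for x
    by (rule has_field_derivative_transform_within[OF f'(1)[rule_format, OF that] zero_less_one])
      (use that assms(1) in auto)
  with f'(2) Suc show ?thesis by auto
qed

lemma C_on_const: "C_on n a (\<lambda>_. k)"
proof (induction n arbitrary: k)
  case (Suc n)
  show ?case by (rule C_on_SucI[where f' = "\<lambda>_. 0"]) (use Suc in auto)
qed simp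

lemma C_on_add: "C_on n a f \<Longrightarrow> C_on n a g \<Longrightarrow> C_on n a (\<lambda>x. f x + g x)"
proof (induction n arbitrary: f g)
  case (Suc n)
  from Suc.prems obtain f' g' where
    "\<forall>x\<ge>a. (f has_real_derivative f' x) (at x within {a..})" "C_on n a f'"
    "\<forall>x\<ge>a. (g has_real_derivative g' x) (at x within {a..})" "C_on n a g'"
    by auto
  then show ?case
    by (intro C_on_SucI[where f' = "\<lambda>x. f' x + g' x"] Suc.IH) (auto intro: DERIV_add)
qed (auto intro: continuous_on_add)

lemma C_on_mult: "C_on n a f \<Longrightarrow> C_on n a g \<Longrightarrow> C_on n a (\<lambda>x. f x * g x)"
proof (induction n arbitrary: f g)
  case (Suc n)
  from Suc.prems obtain f' g' where
    "\<forall>x\<ge>a. (f has_real_derivative f' x) (at x within {a..})" "C_on n a f'"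
    "\<forall>x\<ge>a. (g has_real_derivative g' x) (at x within {a..})" "C_on n a g'"
    by auto
  moreover have "C_on n a f" "C_on n a g"
    using Suc.prems C_on_SucD by blast+
  ultimately show ?case
    by (intro C_on_SucI[where f' = "\<lambda>x. f' x * g x + g' x * f x"] C_on_add Suc.IH)
      (auto intro: DERIV_mult)
qed (auto intro: continuous_on_mult)

lemma C_on_inverse:
  assumes "\<And>x. x \<ge> a \<Longrightarrow> f x \<noteq> 0"
  shows "C_on n a f \<Longrightarrow> C_on n a (\<lambda>x. inverse (f x))"
proof (induction n)
  case 0
  then show ?case using assms by (auto intro!: continuous_on_inverse)
next
  case (Suc n)
  from Suc.prems obtain f' where
    "\<forall>x\<ge>a. (f has_real_derivative f' x) (at x within {a..})" "C_on n a f'"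
    by auto
  moreover have "C_on n a (\<lambda>x. inverse (f x))"
    using Suc C_on_SucD by blast
  ultimately show ?case
    using assms
    by (intro C_on_SucI[where f' = "\<lambda>x. (-1) * (inverse (f x) * f' x * inverse (f x))"] C_on_mult C_on_const)
      (auto intro!: derivative_eq_intros)
qed

lemma C_on_exp: "C_on n a f \<Longrightarrow> C_on n a (\<lambda>x. exp (f x))"
proof (induction n)
  case 0
  then show ?case by (auto intro!: continuous_on_exp)
next
  case (Suc n)
  from Suc.prems obtain f' where
    "\<forall>x\<ge>a. (f has_real_derivative f' x) (at x within {a..})" "C_on n a f'"
    by auto
  moreover have "C_on n a (\<lambda>x. exp (f x))"
    using Suc C_on_SucD by blast
  ultimately show ?case
    by (intro C_on_SucI[where f' = "\<lambda>x. exp (f x) * f' x"] C_on_mult)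
      (auto intro!: derivative_eq_intros)
qed

lemma integral_has_real_derivative_atLeast:
  fixes g :: "real \<Rightarrow> real"
  assumes "continuous_on {a..} g" "a \<le> t"
  shows "((\<lambda>u. integral {a..u} g) has_real_derivative g t) (at t within {a..})"
proof -
  \<comment> \<open>Ending the interval at \<open>t + 1\<close> keeps \<open>t\<close> away from its
    right end, so that near \<open>t\<close> it coincides with the half-line, also when
    \<open>t = a\<close>.\<close>
  have "((\<lambda>u. integral {a..u} g) has_real_derivative g t) (at t within {a..t+1})"
    using assms by (intro integral_has_real_derivative) (auto intro: continuous_on_subset)
  moreover have "at t within {a..t+1} = at t within {a..}"
    by (rule at_within_nhd[where S = "{..<t+1}"]) auto
  ultimately show ?thesis by simp
qed

lemma C_on_integral:
  assumes "C_on n a g"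
  shows "C_on (Suc n) a (\<lambda>t. integral {a..t} g)"
proof -
  have "C_on 0 a g"
    using assms by (induction n) (auto intro: C_on_SucD simp del: C_on.simps)
  then show ?thesis
    using assms by (intro C_on_SucI[where f' = g] integral_has_real_derivative_atLeast) auto
qed

section \<open>Flat functions and smooth steps\<close>

definition flat :: "nat \<Rightarrow> real \<Rightarrow> real" where
  "flat k x = (if x \<le> 0 then 0 else exp (- (1 / x)) / x ^ k)"

text \<open>The denominators \<open>x ^ k\<close> are carried along so that the derivative of a
  member of the family is again a linear combination of members; smoothness then follows by
  induction over all \<open>k\<close> at once. The delicate point is the origin.\<close>

lemma flat_has_derivative:
  "(flat k has_real_derivative flat (k + 2) x - real k * flat (k + 1) x) (at x)"
proof (cases x "0::real" rule: linorder_cases)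
  case less
  have "((\<lambda>_. 0) has_real_derivative 0) (at x)" by simp
  then have "(flat k has_real_derivative 0) (at x)"
    by (rule has_field_derivative_transform_within_open[where S = "{..<0}"])
      (use less in \<open>auto simp: flat_def\<close>)
  with less show ?thesis by (simp add: flat_def)
next
  case equal
  \<comment> \<open>Under \<open>z = inverse h\<close> the difference quotient
    \<open>flat k h / h\<close> at 0 becomes \<open>z ^ (k + 1) / exp z\<close>.\<close>
  have "((\<lambda>z::real. z ^ (k + 1) / exp z) \<longlongrightarrow> 0) at_top"
    by (rule tendsto_power_div_exp_0)
  from filterlim_compose[OF this filterlim_inverse_at_top_right]
  have "((\<lambda>h::real. inverse h ^ (k + 1) / exp (inverse h)) \<longlongrightarrow> 0) (at_right 0)" .
  then have "((\<lambda>h. flat k h / h) \<longlongrightarrow> 0) (at_right 0)"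
    by (rule Lim_transform_eventually)
      (auto simp: eventually_at_filter flat_def field_simps exp_minus intro!: always_eventually)
  moreover have "((\<lambda>h. flat k h / h) \<longlongrightarrow> 0) (at_left 0)"
    by (rule Lim_transform_eventually[OF tendsto_const])
      (auto simp: eventually_at_filter flat_def intro!: always_eventually)
  ultimately have "((\<lambda>h. flat k h / h) \<longlongrightarrow> 0) (at 0)"
    by (simp add: filterlim_split_at)
  with equal show ?thesis
    by (simp add: has_field_derivative_iff flat_def)
next
  case greater
  have "((\<lambda>x. - (1 / x)) has_real_derivative 1 / x\<^sup>2) (at x)"
    using greater by (auto intro!: derivative_eq_intros simp: power2_eq_square)
  then have "((\<lambda>x. exp (- (1 / x))) has_real_derivative exp (- (1 / x)) * (1 / x\<^sup>2)) (at x)"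
    by (rule DERIV_fun_exp)
  moreover have "((\<lambda>x. x ^ k) has_real_derivative real k * x ^ (k - Suc 0)) (at x)"
    by (rule DERIV_pow)
  ultimately have "((\<lambda>x. exp (- (1 / x)) / x ^ k) has_real_derivative
      (exp (- (1 / x)) * (1 / x\<^sup>2) * x ^ k - exp (- (1 / x)) * (real k * x ^ (k - Suc 0)))
        / (x ^ k * x ^ k)) (at x)"
    using greater by (intro DERIV_divide) auto
  also have "(exp (- (1 / x)) * (1 / x\<^sup>2) * x ^ k - exp (- (1 / x)) * (real k * x ^ (k - Suc 0)))
        / (x ^ k * x ^ k) = flat (k + 2) x - real k * flat (k + 1) x"
    using greater by (cases k) (simp_all add: flat_def diff_divide_distrib power2_eq_square)
  finally show ?thesis
    by (rule has_field_derivative_transform_within_open[where S = "{0<..}"])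
      (use greater in \<open>auto simp: flat_def\<close>)
qed

lemma C_on_flat: "C_on n a (\<lambda>x. flat k (p + q * x))"
proof (induction n arbitrary: k)
  case 0
  have "isCont (flat k) x" for x
    by (rule DERIV_isCont[OF flat_has_derivative])
  then have "continuous_on UNIV (flat k)"
    by (simp add: continuous_on_eq_continuous_at)
  moreover have "continuous_on {a..} (\<lambda>x. p + q * x)"
    by (intro continuous_intros)
  ultimately have "continuous_on {a..} (\<lambda>x. flat k (p + q * x))"
    by (rule continuous_on_compose2) simp
  then show ?case by simp
next
  case (Suc n)
  have D: "((\<lambda>x. flat k (p + q * x)) has_real_derivative
      (flat (k + 2) (p + q * x) + (- real k) * flat (k + 1) (p + q * x)) * q) (at x within {a..})" for x
  proof (rule DERIV_cong[OF DERIV_chain2[OF flat_has_derivative]])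
    show "((\<lambda>x. p + q * x) has_real_derivative q) (at x within {a..})"
      by (auto intro!: derivative_eq_intros)
  qed simp
  show ?case
    by (rule C_on_SucI[OF D]) (intro C_on_mult C_on_add C_on_const Suc)
qed

lemma flat_0_nonneg: "flat 0 x \<ge> 0"
  and flat_0_pos: "x > 0 \<Longrightarrow> flat 0 x > 0"
  by (auto simp: flat_def)

text \<open>
  On \<open>(0, 1)\<close> this is \<open>8 / (8 / c + exp (1 / x - 1 / (1 - x)))\<close>; the number 8 is what the bound
  \<open>step' \<le> step\<^sup>2\<close> on \<open>[1/2, 1]\<close> requires.
\<close>

definition step :: "real \<Rightarrow> real \<Rightarrow> real" where
  "step c x = flat 0 x / (flat 0 x / c + flat 0 (1 - x) / 8)"

text \<open>Both summands are nonnegative, and \<open>x\<close> and \<open>1 - x\<close> cannot both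
  be nonpositive.\<close>

lemma step_denominator_pos:
  assumes "c > 0"
  shows "flat 0 x / c + flat 0 (1 - x) / 8 > 0"
proof (cases "x > 0")
  case True
  with assms show ?thesis
    by (intro add_pos_nonneg divide_pos_pos) (auto simp: flat_0_nonneg flat_0_pos)
next
  case False
  with assms show ?thesis
    by (intro add_nonneg_pos divide_nonneg_pos) (auto simp: flat_0_nonneg flat_0_pos)
qed

lemma step_eq_0: "x \<le> 0 \<Longrightarrow> step c x = 0"
  by (simp add: step_def flat_def)

lemma step_eq_top: "x \<ge> 1 \<Longrightarrow> step c x = c"
  by (simp add: step_def flat_def)

lemma step_nonneg: "c > 0 \<Longrightarrow> step c x \<ge> 0"
  unfolding step_def by (intro divide_nonneg_pos flat_0_nonneg step_denominator_pos)

text \<open>On this half \<open>flat 0 x\<close> is at most \<open>flat 0 (1 - x)\<close>, so the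
  second summand of the denominator alone gives the bound, whatever the height
  \<open>c\<close>.\<close>

lemma step_le_8:
  assumes "c > 0" "x \<le> 1/2"
  shows "step c x \<le> 8"
proof -
  have "flat 0 x \<le> flat 0 (1 - x)"
    using assms by (auto simp: flat_def frac_le)
  also have "\<dots> \<le> 8 * (flat 0 x / c + flat 0 (1 - x) / 8)"
    using assms flat_0_nonneg[of x] by simp
  finally show ?thesis
    using step_denominator_pos[OF assms(1)] by (simp add: step_def pos_divide_le_eq)
qed

lemma C_on_step:
  assumes "c > 0"
  shows "C_on n a (\<lambda>t. step c (t - b))"
proof -
  have "C_on n a (\<lambda>t. flat 0 (- b + 1 * t) *
      inverse (inverse c * flat 0 (- b + 1 * t) + inverse 8 * flat 0 (1 + b + (-1) * t)))"
  proof (intro C_on_mult C_on_inverse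
      [where f = "\<lambda>t. inverse c * flat 0 (- b + 1 * t) + inverse 8 * flat 0 (1 + b + (-1) * t)"] C_on_add C_on_const C_on_flat)
    fix x
    show "inverse c * flat 0 (- b + 1 * x) + inverse 8 * flat 0 (1 + b + (-1) * x) \<noteq> 0"
      using step_denominator_pos[OF assms, of "x - b"] by (simp add: field_simps)
  qed
  then show ?thesis
    by (rule C_on_cong[rotated]) (simp add: step_def field_simps)
qed

text \<open>The estimate to which \<open>step' \<le> step\<^sup>2\<close> reduces. At
  \<open>x = 1/2\<close> it is an equality, which fixes the constant 8. For larger \<open>x\<close>
  the quadratic growth of \<open>1 / (1 - x)\<^sup>2\<close> is absorbed by the exponential in
  \<open>flat 0 (1 - x)\<close>.\<close>

lemma flat_ratio_bound:
  assumes "1/2 \<le> x" "x < 1"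
  shows "flat 0 (1 - x) * (1 / x\<^sup>2 + 1 / (1 - x)\<^sup>2) \<le> 8 * flat 0 x"
proof -
  \<comment> \<open>Measured from its value at \<open>x = 1/2\<close>, so that
    \<open>u \<ge> 0\<close> and the Taylor bound for \<open>exp u\<close> applies.\<close>
  define u where "u = 1 / (1 - x) - 2"
  have u: "u \<ge> 0" and z: "1 / (1 - x) = u + 2"
    using assms by (auto simp: u_def field_simps)
  have x: "1 / x \<le> 2" "0 \<le> 1 / x" using assms by (auto simp: field_simps)
  have "(1 / x)\<^sup>2 \<le> 2\<^sup>2" using x by (rule power_mono)
  then have "1 / x\<^sup>2 + 1 / (1 - x)\<^sup>2 \<le> 4 + (u + 2)\<^sup>2"
    unfolding z[symmetric] by (simp add: power_one_over)
  also have "\<dots> \<le> 8 * (1 + u + u\<^sup>2 / 2)"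
    using u by (simp add: power2_eq_square algebra_simps)
  also have "\<dots> \<le> 8 * exp u"
    using exp_lower_Taylor_quadratic[OF u] by simp
  finally have "exp (- (u + 2)) * (1 / x\<^sup>2 + 1 / (1 - x)\<^sup>2) \<le> exp (- (u + 2)) * (8 * exp u)"
    by (rule mult_left_mono) simp
  also have "\<dots> = 8 * exp (- 2)"
    by (simp add: mult_exp_exp mult.left_commute)
  also have "\<dots> \<le> 8 * exp (- (1 / x))"
    using x by simp
  finally show ?thesis
    using assms z by (simp add: flat_def)
qed

text \<open>In the quotient rule the terms with \<open>c\<close> cancel: the derivative is
  \<open>(f' g - f g') / (8 D\<^sup>2)\<close>, while the square is
  \<open>f\<^sup>2 / D\<^sup>2\<close>. After removing \<open>D\<^sup>2\<close> the inequality no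
  longer involves \<open>c\<close>, so the steps may be arbitrarily high.\<close>

lemma step_derivative_le_square:
  assumes "c > 0" "1/2 \<le> x" "x \<le> 1"
  shows "\<exists>d. (step c has_real_derivative d) (at x) \<and> d \<le> (step c x)\<^sup>2"
proof -
  define f g where "f = flat 0" and "g = (\<lambda>x. flat 0 (1 - x))"
  define D where "D = f x / c + g x / 8"
  have f: "(f has_real_derivative flat 2 x) (at x)"
    using flat_has_derivative[of 0 x] by (simp add: f_def numeral_2_eq_2)
  have "(flat 0 has_real_derivative flat 2 (1 - x)) (at (1 - x))"
    using flat_has_derivative[of 0 "1 - x"] by (simp add: numeral_2_eq_2)
  then have "((\<lambda>x. flat 0 (1 - x)) has_real_derivative flat 2 (1 - x) * (- 1)) (at x)"
    by (rule DERIV_chain2) (auto intro!: derivative_eq_intros)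
  then have g: "(g has_real_derivative - flat 2 (1 - x)) (at x)"
    by (simp add: g_def)
  have D: "D > 0"
    using step_denominator_pos[OF assms(1)] by (simp add: D_def f_def g_def)
  have "((\<lambda>x. f x / (f x / c + g x / 8)) has_real_derivative
      (flat 2 x * D - f x * (flat 2 x / c + (- flat 2 (1 - x)) / 8)) / (D * D)) (at x)"
    unfolding D_def
    by (intro DERIV_divide DERIV_add DERIV_cdivide f g) (use D in \<open>simp add: D_def\<close>)
  also have "flat 2 x * D - f x * (flat 2 x / c + (- flat 2 (1 - x)) / 8)
      = (flat 2 x * g x + f x * flat 2 (1 - x)) / 8"
    by (simp add: D_def algebra_simps add_divide_distrib)
  finally have "(step c has_real_derivative
      (flat 2 x * g x + f x * flat 2 (1 - x)) / 8 / D\<^sup>2) (at x)"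
    by (simp add: step_def[abs_def] f_def g_def power2_eq_square)
  moreover have "flat 2 x * g x + f x * flat 2 (1 - x) \<le> 8 * (f x)\<^sup>2"
  proof (cases "x = 1")
    case False
    with assms have x: "x < 1" by simp
    have "flat 2 x = f x / x\<^sup>2" "flat 2 (1 - x) = flat 0 (1 - x) / (1 - x)\<^sup>2"
      by (simp_all add: f_def flat_def)
    then have "flat 2 x * g x + f x * flat 2 (1 - x)
        = f x * (flat 0 (1 - x) * (1 / x\<^sup>2 + 1 / (1 - x)\<^sup>2))"
      by (simp add: g_def distrib_left)
    also have "\<dots> \<le> f x * (8 * flat 0 x)"
      using x assms by (intro mult_left_mono flat_ratio_bound) (auto simp: f_def flat_0_nonneg)
    finally show ?thesis by (simp add: f_def power2_eq_square mult.left_commute)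
  qed (simp add: f_def g_def flat_def)
  then have "(flat 2 x * g x + f x * flat 2 (1 - x)) / 8 / D\<^sup>2 \<le> (f x)\<^sup>2 / D\<^sup>2"
    by (intro divide_right_mono) auto
  moreover have "(f x)\<^sup>2 / D\<^sup>2 = (step c x)\<^sup>2"
    by (simp add: f_def g_def D_def step_def power_divide)
  ultimately show ?thesis by metis
qed

section \<open>Solution of the infinite system and its smoothness\<close>

primrec approx :: "(nat \<Rightarrow> real) \<Rightarrow> nat \<Rightarrow> nat \<Rightarrow> real \<Rightarrow> real" where
  "approx c 0 m = (\<lambda>t. 0)"
| "approx c (Suc k) m =
    (\<lambda>t. step (c m) (t - real m) * exp (integral {0..t} (approx c k (Suc m))))"

text \<open>The functions \<open>approx c k m\<close> are the iterates of the system started at 0.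
  At a given \<open>t\<close> they no longer change once \<open>k \<ge> t\<close>, so this diagonal
  value is their limit.\<close>

definition tower :: "(nat \<Rightarrow> real) \<Rightarrow> nat \<Rightarrow> real \<Rightarrow> real" where
  "tower c m t = approx c (nat \<lceil>t\<rceil>) m t"

text \<open>Unfolding one equation replaces \<open>m\<close> by \<open>m + 1\<close> and
  \<open>k\<close> by \<open>k - 1\<close>, which preserves \<open>m + k\<close>. At
  \<open>k = 0\<close> the claim is that the step vanishes up to time \<open>m\<close>.\<close>

lemma approx_Suc_eq: "t \<le> real (m + k) \<Longrightarrow> approx c (Suc k) m t = approx c k m t"
proof (induction k arbitrary: m t)
  case (Suc k)
  have "integral {0..t} (approx c (Suc k) (Suc m)) = integral {0..t} (approx c k (Suc m))"
    by (rule integral_cong, rule Suc.IH) (use Suc.prems in auto)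
  then show ?case by (metis approx.simps(2))
qed (simp add: step_eq_0)

lemma approx_stable: "k \<le> j \<Longrightarrow> t \<le> real k \<Longrightarrow> approx c j m t = approx c k m t"
proof (induction j rule: dec_induct)
  case (step j)
  then show ?case using approx_Suc_eq[of t m j c] by simp
qed simp

lemma tower_eq_approx: "t \<le> real k \<Longrightarrow> tower c m t = approx c k m t"
  unfolding tower_def by (rule approx_stable[symmetric]) linarith+

lemma tower_unfold:
  "tower c m t = step (c m) (t - real m) * exp (integral {0..t} (tower c (Suc m)))"
proof -
  define k where "k = nat \<lceil>t\<rceil>"
  have k: "t \<le> real k" unfolding k_def by linarith
  have "integral {0..t} (approx c k (Suc m)) = integral {0..t} (tower c (Suc m))"
    by (rule integral_cong, rule tower_eq_approx[symmetric]) (use k in auto)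
  moreover have "tower c m t = approx c (Suc k) m t"
    using k by (intro tower_eq_approx) auto
  ultimately show ?thesis by simp
qed

lemma continuous_on_approx:
  assumes "\<And>m. c m > 0"
  shows "continuous_on {0..} (approx c k m)"
proof (induction k arbitrary: m)
  case (Suc k)
  have "C_on 0 0 (\<lambda>t. step (c m) (t - real m) * exp (integral {0..t} (approx c k (Suc m))))"
    by (intro C_on_mult C_on_step C_on_exp C_on_SucD[OF C_on_integral] assms)
      (use Suc in simp)
  then show ?case by simp
qed simp

lemma continuous_on_tower:
  assumes "\<And>m. c m > 0"
  shows "continuous_on {0..} (tower c m)"
  unfolding continuous_on_eq_continuous_within
proof
  fix x :: real assume x: "x \<in> {0..}"
  obtain k where k: "x < real k" using reals_Archimedean2 by blast
  have "continuous_on {0..real k} (approx c k m)"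
    using continuous_on_approx[of c, OF assms] by (rule continuous_on_subset) auto
  then have "continuous_on {0..real k} (tower c m)"
    by (subst continuous_on_cong[OF refl tower_eq_approx]) auto
  then have "continuous (at x within {0..real k}) (tower c m)"
    using x k by (simp add: continuous_on_eq_continuous_within)
  moreover have "at x within {0..real k} = at x within {0..}"
    by (rule at_within_nhd[where S = "{..<real k}"]) (use k in auto)
  ultimately show "continuous (at x within {0..}) (tower c m)" by simp
qed

text \<open>Bootstrapping for all \<open>m\<close> simultaneously: integrating
  \<open>tower c (Suc m)\<close> gains one order, and the equation passes it to
  \<open>tower c m\<close>. The interval starts at 0 for every \<open>n\<close>.\<close>

lemma C_on_tower:
  assumes "\<And>m. c m > 0"
  shows "C_on n 0 (tower c m)"
proof (induction n arbitrary: m)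
  case 0
  show ?case using continuous_on_tower[of c, OF assms] by simp
next
  case (Suc n)
  have "C_on (Suc n) 0 (\<lambda>t. step (c m) (t - real m) * exp (integral {0..t} (tower c (Suc m))))"
    by (intro C_on_mult C_on_step C_on_exp C_on_integral assms Suc)
  then show ?case by (rule C_on_cong[rotated]) (rule tower_unfold[symmetric])
qed

lemma tower_nonneg: "(\<And>m. c m > 0) \<Longrightarrow> tower c m t \<ge> 0"
  by (subst tower_unfold) (simp add: step_nonneg)

lemma tower_eq_0: "t \<le> real m \<Longrightarrow> tower c m t = 0"
  by (subst tower_unfold) (simp add: step_eq_0)

text \<open>Up to time \<open>m + 1\<close> the next member is still zero, so the exponential factor
  is 1.\<close>

lemma tower_eq_step:
  assumes "t \<le> real (Suc m)"
  shows "tower c m t = step (c m) (t - real m)"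
proof -
  have "integral {0..t} (tower c (Suc m)) = integral {0..t} (\<lambda>_. 0)"
    by (rule integral_cong, rule tower_eq_0) (use assms in auto)
  then show ?thesis by (subst tower_unfold) simp
qed

lemma tower_eq_exp:
  "t \<ge> real (Suc m) \<Longrightarrow> tower c m t = c m * exp (integral {0..t} (tower c (Suc m)))"
  by (subst tower_unfold) (simp add: step_eq_top)

lemma tower_integrable:
  assumes "\<And>m. c m > 0" "0 \<le> s"
  shows "tower c m integrable_on {s..t}"
  using continuous_on_tower[of c m, OF assms(1)] assms(2)
  by (intro integrable_continuous_interval) (auto intro: continuous_on_subset)

lemma tower_ge:
  assumes "\<And>m. c m > 0" "t \<ge> real (Suc m)"
  shows "tower c m t \<ge> c m"
proof -
  have "integral {0..t} (tower c (Suc m)) \<ge> 0"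
    by (intro integral_nonneg tower_integrable tower_nonneg assms) auto
  with assms show ?thesis by (simp add: tower_eq_exp less_imp_le)
qed

lemma tower_has_derivative:
  assumes "\<And>m. c m > 0" "t > real (Suc m)"
  shows "(tower c m has_real_derivative tower c m t * tower c (Suc m) t) (at t)"
proof -
  let ?I = "\<lambda>t. integral {0..t} (tower c (Suc m))"
  have "(?I has_real_derivative tower c (Suc m) t) (at t within {0..})"
    by (intro integral_has_real_derivative_atLeast continuous_on_tower assms)
      (use assms in auto)
  moreover have "at t within {0..} = at t"
    using assms by (intro at_within_interior) auto
  ultimately have "(?I has_real_derivative tower c (Suc m) t) (at t)" by simp
  then have "((\<lambda>t. c m * exp (?I t)) has_real_derivative tower c m t * tower c (Suc m) t) (at t)"
    using assms(2) by (auto intro!: derivative_eq_intros simp: tower_eq_exp)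
  then show ?thesis
    by (rule has_field_derivative_transform_within_open[where S = "{real (Suc m)<..}"])
      (use assms in \<open>auto simp: tower_eq_exp\<close>)
qed

text \<open>From \<open>m + 1\<close> on the step is constant, so growth after time \<open>s\<close>
  depends only on the next member; this carries comparisons from \<open>s\<close> to later
  times.\<close>

lemma tower_integral_split:
  assumes "\<And>m. c m > 0" "real (Suc m) \<le> s" "s \<le> t"
  shows "tower c m t = tower c m s * exp (integral {s..t} (tower c (Suc m)))"
proof -
  have "integral {0..s} (tower c (Suc m)) + integral {s..t} (tower c (Suc m))
      = integral {0..t} (tower c (Suc m))"
    using assms by (intro Henstock_Kurzweil_Integration.integral_combine tower_integrable) auto
  then show ?thesis
    using assms by (simp add: tower_eq_exp exp_add[symmetric] mult.assoc)
qed

section \<open>Comparison of the members with each other and with \<phi>\<close>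

lemma tower_decreasing_initial:
  assumes c: "\<And>m. c m > 8" and t: "real (Suc m) \<le> t" "t \<le> real (Suc (Suc m))"
  shows "tower c (Suc m) t < tower c m t"
proof -
  have c0: "c m > 0" for m using c[of m] by linarith
  note ge = tower_ge[of c m, OF c0]
  \<comment> \<open>The midpoint of the rise of \<open>tower c (Suc m)\<close>: the bound by 8 holds
    up to here, and \<open>step' \<le> step\<^sup>2\<close> holds from here on.\<close>
  define p where "p = real (Suc m) + 1/2"
  have early: "tower c (Suc m) s \<le> 8" if "s \<le> p" for s
    using that c0 by (subst tower_eq_step) (auto simp: p_def intro!: step_le_8)
  show ?thesis
  proof (cases "t \<le> p")
    case True
    then show ?thesis using early[OF True] ge[OF t(1)] c[of m] by linarith
  next
    case False
    \<comment> \<open>Since the logarithmic derivative of \<open>tower c m\<close> is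
      \<open>tower c (Suc m)\<close>, the derivative of this quotient is
      \<open>(step' - step\<^sup>2) / tower c m\<close>. The numerator is the bare step because it
      agrees with \<open>tower c (Suc m)\<close> only up to \<open>m + 2\<close>, whereas a
      two-sided derivative is wanted there too.\<close>
    let ?q = "\<lambda>s. step (c (Suc m)) (s - real (Suc m)) / tower c m s"
    have "?q t \<le> ?q p"
    proof (rule DERIV_nonpos_imp_nonincreasing[of p t ?q])
      show "p \<le> t" using False by simp
    next
      fix s assume s: "p \<le> s" "s \<le> t"
      let ?v = "step (c (Suc m)) (s - real (Suc m))"
      obtain d where d: "(step (c (Suc m)) has_real_derivative d) (at (s - real (Suc m)))"
        "d \<le> ?v\<^sup>2"
        using step_derivative_le_square[OF c0, of "s - real (Suc m)" "Suc m"] s t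
        by (auto simp: p_def)
      have "tower c m s > 0" using ge[of s] s c0[of m] by (simp add: p_def)
      moreover have "tower c (Suc m) s = ?v"
        using s t by (intro tower_eq_step) auto
      moreover have "(tower c m has_real_derivative tower c m s * tower c (Suc m) s) (at s)"
        using s by (intro tower_has_derivative c0) (auto simp: p_def)
      moreover have "((\<lambda>s. step (c (Suc m)) (s - real (Suc m))) has_real_derivative d) (at s)"
        using d(1) DERIV_shift[of "step (c (Suc m))" d s "- real (Suc m)"]
        by (simp del: of_nat_Suc)
      ultimately have "(?q has_real_derivative (d - ?v\<^sup>2) / tower c m s) (at s)"
        by (auto intro!: derivative_eq_intros simp: field_simps power2_eq_square)
      then show "\<exists>y. (?q has_real_derivative y) (at s) \<and> y \<le> 0"
        using d(2) \<open>tower c m s > 0\<close> by (auto intro!: exI divide_nonpos_pos)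
    qed
    also have "?q p < 1"
      using early[of p] ge[of p] c[of m] tower_eq_step[of p "Suc m" c] by (simp add: p_def)
    finally have "tower c (Suc m) t / tower c m t < 1"
      using tower_eq_step[of t "Suc m" c] t by simp
    then show ?thesis
      using ge[OF t(1)] c0[of m] by simp
  qed
qed

text \<open>Induction on the number of unit intervals up to \<open>t\<close>, for all
  \<open>m\<close> at once. Past \<open>m + 2\<close>, both members grow by the exponential of the
  integral of their successors. These are ordered by the induction hypothesis for
  \<open>m + 1\<close>, which has one interval less to cover, and the values at \<open>m + 2\<close>
  are ordered by the initial case.\<close>

lemma tower_decreasing:
  assumes c: "\<And>m. c m > 8" and t: "real (Suc m) \<le> t"
  shows "tower c (Suc m) t < tower c m t"
proof -
  have c0: "c m > 0" for m using c[of m] by linarith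
  have "tower c (Suc m) t < tower c m t" if "real (Suc m) \<le> t" "t \<le> real (Suc m + j)" for j m t
    using that
  proof (induction j arbitrary: m t)
    case 0
    then show ?case by (intro tower_decreasing_initial c) auto
  next
    case (Suc j)
    define s where "s = real (Suc (Suc m))"
    show ?case
    proof (cases "t \<le> s")
      case True
      then show ?thesis using Suc.prems by (intro tower_decreasing_initial c) (auto simp: s_def)
    next
      case False
      have "integral {s..t} (tower c (Suc (Suc m))) \<le> integral {s..t} (tower c (Suc m))"
        by (intro integral_le tower_integrable c0 less_imp_le[OF Suc.IH])
          (use Suc.prems in \<open>auto simp: s_def\<close>)
      moreover have "tower c (Suc m) s < tower c m s"
        by (intro tower_decreasing_initial c) (auto simp: s_def)
      ultimately have "tower c (Suc m) s * exp (integral {s..t} (tower c (Suc (Suc m))))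
          < tower c m s * exp (integral {s..t} (tower c (Suc m)))"
        by (intro mult_less_le_imp_less tower_nonneg c0) auto
      then show ?thesis
        using False tower_integral_split[of c "Suc m" s t, OF c0]
          tower_integral_split[of c m s t, OF c0] by (simp add: s_def)
    qed
  qed
  moreover obtain j where "t \<le> real j" using real_arch_simple by blast
  ultimately show ?thesis using t by (meson le_add2 of_nat_le_iff order_trans)
qed

lemma tower_antimono:
  assumes c: "\<And>m. c m > 8" and "m \<le> j" "real j \<le> t"
  shows "tower c j t \<le> tower c m t"
  using assms(2,3)
proof (induction j rule: dec_induct)
  case (step j)
  have "tower c (Suc j) t < tower c j t"
    using step by (intro tower_decreasing c) auto
  with step show ?case by auto
qed simp

lemma tower_dominates:
  assumes c: "\<And>m. c m > 8" and \<phi>: "\<And>m t. a \<le> t \<Longrightarrow> t \<le> real m + 2 \<Longrightarrow> \<phi> t < c m"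
    and t: "a \<le> t" "real (Suc m) \<le> t"
  shows "\<phi> t < tower c m t"
proof -
  have c0: "c m > 0" for m using c[of m] by linarith
  \<comment> \<open>Chosen so that \<open>t\<close> lies between \<open>j + 1\<close> and
    \<open>j + 2\<close>, where \<open>c j\<close> bounds \<phi> and \<open>tower c j\<close> has
    already reached \<open>c j\<close>. The subtraction is not truncated, since
    \<open>t \<ge> m + 1\<close>.\<close>
  define j where "j = nat \<lfloor>t\<rfloor> - 1"
  have j: "m \<le> j" "real (Suc j) \<le> t" "t \<le> real j + 2"
    using t unfolding j_def by linarith+
  have "\<phi> t < c j" using \<phi> t j by blast
  also have "\<dots> \<le> tower c j t" using j by (intro tower_ge c0)
  also have "\<dots> \<le> tower c m t" using j by (intro tower_antimono c) auto
  finally show ?thesis .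
qed

section \<open>Passage to germs and choice of the constants\<close>

lemma unit_C_lt_infty_tower:
  assumes "\<And>m. c m > 0"
  shows "unit_C_lt_infty (germ_of (tower c m))"
proof -
  have pos: "tower c m t \<noteq> 0" if "t \<ge> real (Suc m)" for t
    using tower_ge[of c, OF assms that] assms[of m] by linarith
  \<comment> \<open>The function vanishes up to \<open>m\<close>, so its inverse is taken only from
    \<open>m + 1\<close> on, where it is at least \<open>c m\<close>.\<close>
  have "C_on n (real (Suc m)) (\<lambda>t. inverse (tower c m t))" for n
    by (intro C_on_inverse pos C_on_subset[OF C_on_tower] assms) auto
  then have "germ_of (\<lambda>t. inverse (tower c m t)) \<in> C_lt_infty_germs"
    unfolding C_lt_infty_germs_def C_n_germs_def by blast
  moreover have "germ_of (tower c m) \<in> C_lt_infty_germs"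
    unfolding C_lt_infty_germs_def C_n_germs_def using C_on_tower[of c, OF assms] by blast
  moreover have "germ_of (tower c m) * germ_of (\<lambda>t. inverse (tower c m t)) = 1"
  proof -
    have "\<forall>\<^sub>F t in at_top. tower c m t * inverse (tower c m t) = 1"
      using eventually_ge_at_top[of "real (Suc m)"] by eventually_elim (use pos in simp)
    then show ?thesis by transfer
  qed
  ultimately show ?thesis unfolding unit_C_lt_infty_def by blast
qed

lemma germ_logderiv_tower:
  assumes "\<And>m. c m > 0"
  shows "germ_deriv (germ_of (tower c m)) / germ_of (tower c m) = germ_of (tower c (Suc m))"
proof -
  have "\<forall>\<^sub>F t in at_top. deriv (tower c m) t / tower c m t = tower c (Suc m) t"
    using eventually_gt_at_top[of "real (Suc m)"]
  proof eventually_elim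
    case (elim t)
    with tower_ge[of c m t, OF assms] assms[of m] have "tower c m t \<noteq> 0" by linarith
    with elim show ?case
      using DERIV_imp_deriv[OF tower_has_derivative[of c, OF assms elim]] by simp
  qed
  then show ?thesis by transfer
qed

lemma iter_logderiv_tower:
  assumes "\<And>m. c m > 0"
  shows "iter_logderiv (germ_of (tower c 0)) m = Some (germ_of (tower c m))"
  using assms
  by (induction m) (simp_all add: unit_C_lt_infty_tower germ_logderiv_tower)

theorem theorem5p12:
  "\<forall>\<phi>\<in>C_germs. \<exists>y\<in>C_infty_germs. overhardian y \<and>
     (\<forall>m. \<exists>z. iter_logderiv y m = Some z \<and> \<phi> <\<^sub>e z)"
proof
  fix \<Phi> assume "\<Phi> \<in> C_germs"
  then obtain \<phi> a where \<Phi>: "\<Phi> = germ_of \<phi>" and cont: "continuous_on {a..} \<phi>"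
    unfolding C_germs_def by blast
  have "\<exists>K>8. \<forall>t. a \<le> t \<longrightarrow> t \<le> real m + 2 \<longrightarrow> \<phi> t < K" for m
  proof -
    have "compact (\<phi> ` {a..real m + 2})"
      by (intro compact_continuous_image continuous_on_subset[OF cont]) auto
    then have "bdd_above (\<phi> ` {a..real m + 2})"
      by (intro bounded_imp_bdd_above compact_imp_bounded)
    then obtain K where "\<And>t. t \<in> {a..real m + 2} \<Longrightarrow> \<phi> t \<le> K"
      by (metis bdd_above_def imageI)
    \<comment> \<open>The summand 1 makes both inequalities strict. If \<open>a > m + 2\<close>, the
      interval is empty and only the bound 8 matters.\<close>
    then show ?thesis by (intro exI[of _ "max K 8 + 1"]) (force simp: max_def)
  qed
  then obtain c where c: "\<And>m. c m > 8"
    and bound: "\<And>m t. a \<le> t \<Longrightarrow> t \<le> real m + 2 \<Longrightarrow> \<phi> t < c m"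
    by metis
  have c0: "c m > 0" for m using c[of m] by linarith
  define Y where "Y m = germ_of (tower c m)" for m
  have iter: "iter_logderiv (Y 0) m = Some (Y m)" for m
    unfolding Y_def by (rule iter_logderiv_tower[OF c0])
  have dom: "\<Phi> <\<^sub>e Y m" for m
  proof -
    have "\<forall>\<^sub>F t in at_top. \<phi> t < tower c m t"
      using eventually_ge_at_top[of a] eventually_ge_at_top[of "real (Suc m)"]
      by eventually_elim (rule tower_dominates[of c a \<phi>, OF c bound])
    then show ?thesis unfolding \<Phi> Y_def by transfer
  qed
  have pos: "0 <\<^sub>e Y m" for m
  proof -
    have "\<forall>\<^sub>F t in at_top. 0 < tower c m t"
      using eventually_ge_at_top[of "real (Suc m)"]
      by eventually_elim (use tower_ge[of c, OF c0] c0 in \<open>blast intro: less_le_trans\<close>)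
    then show ?thesis unfolding Y_def by transfer
  qed
  have dec: "Y (Suc m) <\<^sub>e Y m" for m
  proof -
    have "\<forall>\<^sub>F t in at_top. tower c (Suc m) t < tower c m t"
      using eventually_ge_at_top[of "real (Suc m)"]
      by eventually_elim (rule tower_decreasing[of c, OF c])
    then show ?thesis unfolding Y_def by transfer
  qed
  have smooth: "C_on n 0 (tower c 0)" for n by (rule C_on_tower[OF c0])
  then have "Y 0 \<in> C_lt_infty_germs"
    unfolding Y_def C_lt_infty_germs_def C_n_germs_def by blast
  then have "overhardian (Y 0)"
    unfolding overhardian_def using iter pos dec by blast
  moreover have "Y 0 \<in> C_infty_germs"
    unfolding Y_def C_infty_germs_def using smooth by blast
  ultimately show "\<exists>y\<in>C_infty_germs. overhardian y \<and>
      (\<forall>m. \<exists>z. iter_logderiv y m = Some z \<and> \<Phi> <\<^sub>e z)"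
    using iter dom by blast
qed

end
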